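(* Let $(M,d)$ be a complete geodesic space which is Busemann convex, i.e. for all geodesics $\gamma,\eta:[0,1]\to M$ with $\gamma_0=\eta_0$ it holds $d(\gamma_{1/2},\eta_{1/2})\le \tfrac12 d(\gamma_1,\eta_1)$. Then the following three properties are equivalent: (SO) For all geodesics $\gamma,\eta:[0,1]\to M$ with $\gamma_0=\eta_0$ it holds $\gamma\perp_{\gamma_0}\eta$ if and only if $\eta\perp_{\gamma_0}\gamma$. (A) Whenever $\gamma:[0,1]\to M$ is a geodesic and $x\in M$, then for all $t\in[0,1]$ and all $x_C\in\pi_\gamma(x)$ it holds $d(x_C,\gamma_t)\le d(x,\gamma_t)$. (NE) Whenever $C\subset M$ is a closed convex set and $x,y\in M$, then for all $x_C\in\pi_C(x)$ and $y_C\in\pi_C(y)$ it holds $d(x_C,y_C)\le d(x,y)$.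
   Context: A geodesic is a map $\gamma:[0,1]\to M$ with $d(\gamma_t,\gamma_s)=|t-s|\,d(\gamma_0,\gamma_1)$; $(M,d)$ is geodesic if any two points are joined by a geodesic. For geodesics $\gamma,\eta$ with common starting point $p=\gamma_0=\eta_0$, write $\gamma\perp_p\eta$ ("$\gamma$ is orthogonal to $\eta$") if $d(p,\gamma_t)\le d(\eta_s,\gamma_t)$ for all $t,s\in[0,1]$. For $C\subset M$ and $x\in M$, $\pi_C(x)=\{y\in C: d(x,y)=\inf_{z\in C}d(x,z)\}$ is the set of nearest points; $\pi_\gamma$ means $\pi_{\gamma([0,1])}$. A set $C$ is convex if every geodesic joining two points of $C$ lies entirely in $C$. *)

theory Defs
  imports "HOL-Analysis.Analysis"
begin

text \<open>The metric space (M,d) is the whole type 'a, with d = dist.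
  Paths are maps real => 'a; only their values on [0,1] matter.\<close>

definition geodesic :: "(real \<Rightarrow> 'a::metric_space) \<Rightarrow> bool" where
  "geodesic \<gamma> \<longleftrightarrow>
     (\<forall>t\<in>{0..1}. \<forall>s\<in>{0..1}. dist (\<gamma> t) (\<gamma> s) = \<bar>t - s\<bar> * dist (\<gamma> 0) (\<gamma> 1))"

definition geodesic_space :: "'a::metric_space itself \<Rightarrow> bool" where
  "geodesic_space _ \<longleftrightarrow>
     (\<forall>x y::'a. \<exists>\<gamma>. geodesic \<gamma> \<and> \<gamma> 0 = x \<and> \<gamma> 1 = y)"

definition busemann_convex :: "'a::metric_space itself \<Rightarrow> bool" where
  "busemann_convex _ \<longleftrightarrow>
     (\<forall>\<gamma> \<eta> :: real \<Rightarrow> 'a. geodesic \<gamma> \<and> geodesic \<eta> \<and> \<gamma> 0 = \<eta> 0 \<longrightarrow>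
        dist (\<gamma> (1/2)) (\<eta> (1/2)) \<le> 1/2 * dist (\<gamma> 1) (\<eta> 1))"

definition orth :: "(real \<Rightarrow> 'a::metric_space) \<Rightarrow> 'a \<Rightarrow> (real \<Rightarrow> 'a) \<Rightarrow> bool" where
  "orth \<gamma> p \<eta> \<longleftrightarrow>
     (\<forall>t\<in>{0..1}. \<forall>s\<in>{0..1}. dist p (\<gamma> t) \<le> dist (\<eta> s) (\<gamma> t))"

definition proj :: "'a::metric_space set \<Rightarrow> 'a \<Rightarrow> 'a set" where
  "proj C x = {y \<in> C. dist x y = (INF z\<in>C. dist x z)}"

definition geod_convex :: "'a::metric_space set \<Rightarrow> bool" where
  "geod_convex C \<longleftrightarrow>
     (\<forall>\<gamma>. geodesic \<gamma> \<and> \<gamma> 0 \<in> C \<and> \<gamma> 1 \<in> C \<longrightarrow> \<gamma> ` {0..1} \<subseteq> C)"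

definition prop_SO :: "'a::metric_space itself \<Rightarrow> bool" where
  "prop_SO _ \<longleftrightarrow>
     (\<forall>\<gamma> \<eta> :: real \<Rightarrow> 'a. geodesic \<gamma> \<and> geodesic \<eta> \<and> \<gamma> 0 = \<eta> 0 \<longrightarrow>
        (orth \<gamma> (\<gamma> 0) \<eta> \<longleftrightarrow> orth \<eta> (\<gamma> 0) \<gamma>))"

definition prop_A :: "'a::metric_space itself \<Rightarrow> bool" where
  "prop_A _ \<longleftrightarrow>
     (\<forall>(\<gamma> :: real \<Rightarrow> 'a) x. geodesic \<gamma> \<longrightarrow>
        (\<forall>t\<in>{0..1}. \<forall>xC\<in>proj (\<gamma> ` {0..1}) x. dist xC (\<gamma> t) \<le> dist x (\<gamma> t)))"

definition prop_NE :: "'a::metric_space itself \<Rightarrow> bool" where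
  "prop_NE _ \<longleftrightarrow>
     (\<forall>(C :: 'a set) x y. closed C \<and> geod_convex C \<longrightarrow>
        (\<forall>xC\<in>proj C x. \<forall>yC\<in>proj C y. dist xC yC \<le> dist x y))"

end

theory Submission
  imports Defs
begin

text \<open>Only the implication from (A) to (NE) is difficult. Let \<open>p\<close>, \<open>q\<close> be nearest points of \<open>x\<close>, \<open>y\<close>
  on the segment \<open>\<gamma>\<close> from \<open>p\<close> to \<open>q\<close>. Neighbourhoods of \<open>\<gamma>\<close> are convex, so by (A) moving \<open>x\<close> down
  its perpendicular to height \<open>h\<close> does not increase its distance to points of height at most \<open>h\<close>.
  Hence \<open>x\<close> and \<open>y\<close> may be given equal heights. If the segment from \<open>x\<close> to \<open>y\<close> has a point of
  smaller height, both ends can be moved down to that height. Otherwise the four segments span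
  a strip in which all levels are geodesics and \<open>d(x,y) < d(p,q)\<close> is impossible.\<close>

section \<open>Geodesics in metric spaces and a convexity criterion on the unit interval\<close>

lemma geodesic_dist:
  assumes "geodesic \<gamma>" "t \<in> {0..1}" "s \<in> {0..1}"
  shows "dist (\<gamma> t) (\<gamma> s) = \<bar>t - s\<bar> * dist (\<gamma> 0) (\<gamma> 1)"
  using assms unfolding geodesic_def by blast

text \<open>Upper bounds suffice: strictness on one piece would make the path through
  \<open>\<gamma> t\<close> and \<open>\<gamma> s\<close> shorter than
  \<open>dist (\<gamma> 0) (\<gamma> 1)\<close>.\<close>

lemma geodesicI_le:
  assumes le: "\<And>t s. 0 \<le> t \<Longrightarrow> t \<le> s \<Longrightarrow> s \<le> 1 \<Longrightarrow> dist (\<gamma> t) (\<gamma> s) \<le> (s - t) * dist (\<gamma> 0) (\<gamma> 1)"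
  shows "geodesic \<gamma>"
proof -
  have eq: "dist (\<gamma> t) (\<gamma> s) = (s - t) * dist (\<gamma> 0) (\<gamma> 1)" if "0 \<le> t" "t \<le> s" "s \<le> 1" for t s
  proof -
    have "dist (\<gamma> 0) (\<gamma> 1) \<le> dist (\<gamma> 0) (\<gamma> t) + dist (\<gamma> t) (\<gamma> s) + dist (\<gamma> s) (\<gamma> 1)"
      using dist_triangle[of "\<gamma> 0" "\<gamma> 1" "\<gamma> t"] dist_triangle[of "\<gamma> t" "\<gamma> 1" "\<gamma> s"] by linarith
    moreover have "dist (\<gamma> 0) (\<gamma> t) \<le> (t - 0) * dist (\<gamma> 0) (\<gamma> 1)"
      "dist (\<gamma> s) (\<gamma> 1) \<le> (1 - s) * dist (\<gamma> 0) (\<gamma> 1)"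
      by (rule le; use that in linarith)+
    ultimately show ?thesis
      using le[OF that] by (simp add: algebra_simps)
  qed
  show ?thesis
    unfolding geodesic_def
  proof (intro ballI)
    fix t s :: real assume "t \<in> {0..1}" "s \<in> {0..1}"
    then show "dist (\<gamma> t) (\<gamma> s) = \<bar>t - s\<bar> * dist (\<gamma> 0) (\<gamma> 1)"
      using eq[of t s] eq[of s t] by (cases "t \<le> s") (auto simp: dist_commute)
  qed
qed

lemma affine_unit_interval:
  fixes a b t :: real
  assumes "a \<in> {0..1}" "b \<in> {0..1}" "t \<in> {0..1}"
  shows "a + t * (b - a) \<in> {0..1}"
proof -
  have "a + t * (b - a) = (1 - t) *\<^sub>R a + t *\<^sub>R b"
    by (simp add: algebra_simps)
  moreover have "\<dots> \<in> {0..1}"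
    using assms by (intro convexD) auto
  ultimately show ?thesis by simp
qed

text \<open>\<open>a\<close> and \<open>b\<close> are not ordered, so \<open>a = 1\<close>,
  \<open>b = 0\<close> reverses a geodesic.\<close>

lemma geodesic_sub:
  assumes g: "geodesic \<gamma>" and ab: "a \<in> {0..1}" "b \<in> {0..1}"
  shows "geodesic (\<lambda>t. \<gamma> (a + t * (b - a)))"
  unfolding geodesic_def
proof (intro ballI)
  fix t s :: real assume ts: "t \<in> {0..1}" "s \<in> {0..1}"
  have "dist (\<gamma> (a + t * (b - a))) (\<gamma> (a + s * (b - a)))
      = \<bar>(t - s) * (b - a)\<bar> * dist (\<gamma> 0) (\<gamma> 1)"
    using geodesic_dist[OF g affine_unit_interval[OF ab ts(1)] affine_unit_interval[OF ab ts(2)]]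
    by (simp add: algebra_simps)
  also have "\<dots> = \<bar>t - s\<bar> * dist (\<gamma> a) (\<gamma> b)"
    using geodesic_dist[OF g ab] by (simp add: abs_mult abs_minus_commute)
  finally show "dist (\<gamma> (a + t * (b - a))) (\<gamma> (a + s * (b - a)))
      = \<bar>t - s\<bar> * dist (\<gamma> (a + 0 * (b - a))) (\<gamma> (a + 1 * (b - a)))" by simp
qed

lemma geodesic_continuous_on:
  assumes "geodesic \<gamma>"
  shows "continuous_on {0..1} \<gamma>"
proof -
  have "(dist (\<gamma> 0) (\<gamma> 1))-lipschitz_on {0..1} \<gamma>"
  proof (rule lipschitz_onI)
    fix t s :: real assume "t \<in> {0..1}" "s \<in> {0..1}"
    from geodesic_dist[OF assms this] show "dist (\<gamma> t) (\<gamma> s) \<le> dist (\<gamma> 0) (\<gamma> 1) * dist t s"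
      by (simp only: dist_real_def mult.commute order_refl)
  qed simp
  then show ?thesis by (rule lipschitz_on_continuous_on)
qed

text \<open>If the maximum is positive, step equally far to both sides of the leftmost maximiser:
  the left value is strictly smaller, which contradicts midpoint convexity.\<close>

lemma midpoint_convex_continuous_le_0:
  fixes F :: "real \<Rightarrow> real"
  assumes mid: "\<And>a b. a \<in> {0..1} \<Longrightarrow> b \<in> {0..1} \<Longrightarrow> F ((a + b) / 2) \<le> (F a + F b) / 2"
    and cont: "continuous_on {0..1} F"
    and ends: "F 0 = 0" "F 1 = 0"
    and t: "t \<in> {0..1}"
  shows "F t \<le> 0"
proof (rule ccontr)
  assume "\<not> F t \<le> 0"
  obtain m where m: "m \<in> {0..1}" "\<And>s. s \<in> {0..1} \<Longrightarrow> F s \<le> F m"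
    using continuous_attains_sup[OF _ _ cont] by auto
  have pos: "0 < F m" using m(2)[OF t] \<open>\<not> F t \<le> 0\<close> by linarith
  define S where "S = {s \<in> {0..1}. F s = F m}"
  have "closed S"
    unfolding S_def by (intro continuous_closed_preimage_constant cont) auto
  moreover have "S \<noteq> {}" "bdd_below S"
    using m(1) unfolding S_def by (auto intro: bdd_belowI[of _ 0])
  ultimately have S: "Inf S \<in> S" by (rule closed_contains_Inf[rotated 2])
  define i where "i = Inf S"
  have i: "i \<in> {0..1}" "F i = F m" using S unfolding S_def i_def by auto
  have "i \<noteq> 0" "i \<noteq> 1" using i pos ends by auto
  define d where "d = min i (1 - i)"
  have d: "0 < d" "d \<le> i" "d \<le> 1 - i"
    using i \<open>i \<noteq> 0\<close> \<open>i \<noteq> 1\<close> unfolding d_def by auto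
  have "i - d \<notin> S"
    using cInf_lower[OF _ \<open>bdd_below S\<close>, of "i - d"] d unfolding i_def by auto
  then have "F (i - d) < F m"
    using m(2)[of "i - d"] d i unfolding S_def by force
  moreover have "F (i + d) \<le> F m" using m(2)[of "i + d"] d i by auto
  moreover have "F i \<le> (F (i - d) + F (i + d)) / 2"
    using mid[of "i - d" "i + d"] d i by auto
  ultimately show False using i(2) by (simp add: field_simps)
qed

section \<open>Nearest points; equivalence of (SO) and (A)\<close>

lemma mem_proj_iff:
  "y \<in> proj C x \<longleftrightarrow> y \<in> C \<and> (\<forall>z\<in>C. dist x y \<le> dist x z)"
proof (cases "y \<in> C")
  case True
  have bdd: "bdd_below (dist x ` C)" by (auto intro: bdd_belowI[of _ 0])
  have "dist x y = (INF z\<in>C. dist x z)" if "\<forall>z\<in>C. dist x y \<le> dist x z"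
    using that True bdd by (intro antisym cINF_greatest cINF_lower) auto
  moreover have "dist x y \<le> dist x z" if "dist x y = (INF z\<in>C. dist x z)" "z \<in> C" for z
    unfolding that(1) by (rule cINF_lower[OF bdd that(2)])
  ultimately show ?thesis using True unfolding proj_def by blast
qed (auto simp: proj_def)

lemma prop_A_dist_le:
  fixes \<gamma> :: "real \<Rightarrow> 'a::metric_space"
  assumes "prop_A TYPE('a)" "geodesic \<gamma>" "a \<in> {0..1}" "t \<in> {0..1}"
    and "\<And>s. s \<in> {0..1} \<Longrightarrow> dist x (\<gamma> a) \<le> dist x (\<gamma> s)"
  shows "dist (\<gamma> a) (\<gamma> t) \<le> dist x (\<gamma> t)"
proof -
  have "\<gamma> a \<in> proj (\<gamma> ` {0..1}) x" using assms by (auto simp: mem_proj_iff)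
  then show ?thesis using assms(1,2,4) unfolding prop_A_def by blast
qed

text \<open>Orthogonality of \<open>\<gamma>\<close> to \<open>\<eta>\<close> makes the common
  starting point nearest on \<open>\<eta>\<close> to each \<open>\<gamma> s\<close>; (A) along
  \<open>\<eta>\<close> is then the reversed relation.\<close>

lemma prop_A_imp_prop_SO:
  assumes A: "prop_A TYPE('a::metric_space)"
  shows "prop_SO TYPE('a)"
proof -
  have "orth \<eta> (\<gamma> 0) \<gamma>"
    if "geodesic \<eta>" "\<gamma> 0 = \<eta> 0" "orth \<gamma> (\<gamma> 0) \<eta>" for \<gamma> \<eta> :: "real \<Rightarrow> 'a"
    unfolding orth_def
  proof (intro ballI)
    fix t s :: real assume ts: "t \<in> {0..1}" "s \<in> {0..1}"
    have "dist (\<eta> 0) (\<eta> t) \<le> dist (\<gamma> s) (\<eta> t)"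
      using that ts unfolding orth_def
      by (intro prop_A_dist_le[OF A]) (auto simp: dist_commute)
    then show "dist (\<gamma> 0) (\<eta> t) \<le> dist (\<gamma> s) (\<eta> t)" using that by simp
  qed
  then show ?thesis unfolding prop_SO_def by metis
qed

context
  assumes geod: "geodesic_space TYPE('a::metric_space)"
begin

text \<open>A choice, because uniqueness of geodesics is only available once Busemann convexity is
  assumed.\<close>

definition segment :: "'a \<Rightarrow> 'a \<Rightarrow> real \<Rightarrow> 'a" where
  "segment x y = (SOME \<gamma>. geodesic \<gamma> \<and> \<gamma> 0 = x \<and> \<gamma> 1 = y)"

lemma segment: "geodesic (segment x y)" "segment x y 0 = x" "segment x y 1 = y"
proof -
  have "\<exists>\<gamma>. geodesic \<gamma> \<and> \<gamma> 0 = x \<and> \<gamma> 1 = y"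
    using geod unfolding geodesic_space_def by blast
  from someI_ex[OF this] show "geodesic (segment x y)" "segment x y 0 = x" "segment x y 1 = y"
    unfolding segment_def by auto
qed

text \<open>The foot \<open>\<gamma> a\<close> stays nearest for every point of the segment
  \<open>\<eta>\<close> from it to \<open>x\<close>, so \<open>\<eta>\<close> is orthogonal to the
  part \<open>\<beta>\<close> of \<open>\<gamma>\<close> from \<open>\<gamma> a\<close> to
  \<open>\<gamma> t\<close>. The reversed relation, taken at the far ends, is the claim.\<close>

lemma prop_SO_imp_prop_A:
  assumes SO: "prop_SO TYPE('a)"
  shows "prop_A TYPE('a)"
  unfolding prop_A_def
proof (intro allI impI ballI)
  fix \<gamma> :: "real \<Rightarrow> 'a" and x xC and t :: real
  assume g: "geodesic \<gamma>" and t: "t \<in> {0..1}" and "xC \<in> proj (\<gamma> ` {0..1}) x"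
  then obtain a where a: "a \<in> {0..1}" "xC = \<gamma> a"
    and near: "\<forall>s\<in>{0..1}. dist x (\<gamma> a) \<le> dist x (\<gamma> s)"
    by (auto simp: mem_proj_iff)
  define \<beta> where "\<beta> = (\<lambda>s. \<gamma> (a + s * (t - a)))"
  define \<eta> where "\<eta> = segment (\<gamma> a) x"
  have \<eta>: "geodesic \<eta>" "\<eta> 0 = \<gamma> a" "\<eta> 1 = x" unfolding \<eta>_def by (simp_all add: segment)
  have \<beta>: "geodesic \<beta>" "\<beta> 0 = \<gamma> a" "\<beta> 1 = \<gamma> t"
    unfolding \<beta>_def using geodesic_sub[OF g a(1) t] by auto
  have "orth \<eta> (\<eta> 0) \<beta>"
    unfolding orth_def
  proof (intro ballI)
    fix u s :: real assume us: "u \<in> {0..1}" "s \<in> {0..1}"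
    have "dist x (\<gamma> a) \<le> dist x (\<beta> s)"
      unfolding \<beta>_def using near affine_unit_interval[OF a(1) t us(2)] by blast
    moreover have "dist x (\<beta> s) \<le> dist x (\<eta> u) + dist (\<eta> u) (\<beta> s)" by (rule dist_triangle)
    moreover have "dist x (\<eta> u) = (1 - u) * dist x (\<gamma> a)" "dist (\<gamma> a) (\<eta> u) = u * dist x (\<gamma> a)"
      using geodesic_dist[OF \<eta>(1), of 1 u] geodesic_dist[OF \<eta>(1), of 0 u] us \<eta>
      by (auto simp: dist_commute)
    ultimately show "dist (\<eta> 0) (\<eta> u) \<le> dist (\<beta> s) (\<eta> u)"
      using \<eta> by (simp add: algebra_simps dist_commute)
  qed
  then have "orth \<beta> (\<beta> 0) \<eta>"
    using SO \<eta> \<beta> unfolding prop_SO_def by metis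
  then have "dist (\<beta> 0) (\<beta> 1) \<le> dist (\<eta> 1) (\<beta> 1)" unfolding orth_def by auto
  then show "dist xC (\<gamma> t) \<le> dist x (\<gamma> t)" using a \<eta> \<beta> by simp
qed

section \<open>Convexity of the distance, uniqueness of geodesics and midpoints\<close>

context
  assumes bus: "busemann_convex TYPE('a)"
begin

text \<open>The diagonal \<open>\<zeta>\<close> cuts the quadrilateral into triangles with apexes
  \<open>\<gamma> 0\<close> and \<open>\<eta> 1\<close>; for the second one both geodesics are
  reversed.\<close>

lemma busemann_midpoint:
  fixes \<gamma> \<eta> :: "real \<Rightarrow> 'a"
  assumes g: "geodesic \<gamma>" and h: "geodesic \<eta>"
  shows "dist (\<gamma> (1/2)) (\<eta> (1/2)) \<le> (dist (\<gamma> 0) (\<eta> 0) + dist (\<gamma> 1) (\<eta> 1)) / 2"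
proof -
  define \<zeta> where "\<zeta> = segment (\<gamma> 0) (\<eta> 1)"
  have z: "geodesic \<zeta>" "\<zeta> 0 = \<gamma> 0" "\<zeta> 1 = \<eta> 1" unfolding \<zeta>_def by (simp_all add: segment)
  have B: "dist (\<alpha> (1/2)) (\<beta> (1/2)) \<le> 1/2 * dist (\<alpha> 1) (\<beta> 1)"
    if "geodesic \<alpha>" "geodesic \<beta>" "\<alpha> 0 = \<beta> 0" for \<alpha> \<beta> :: "real \<Rightarrow> 'a"
    using bus that unfolding busemann_convex_def by blast
  have "dist (\<gamma> (1/2)) (\<zeta> (1/2)) \<le> 1/2 * dist (\<gamma> 1) (\<eta> 1)"
    using B[OF g z(1)] z by simp
  moreover have "dist (\<zeta> (1/2)) (\<eta> (1/2)) \<le> 1/2 * dist (\<gamma> 0) (\<eta> 0)"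
    using B[OF geodesic_sub[OF z(1), of 1 0] geodesic_sub[OF h, of 1 0]] z by simp
  ultimately show ?thesis
    using dist_triangle[of "\<gamma> (1/2)" "\<eta> (1/2)" "\<zeta> (1/2)"] by (simp add: field_simps)
qed

text \<open>On subsegments the midpoint inequality makes the distance midpoint convex; subtracting
  the chord leaves a function that vanishes at both ends.\<close>

lemma busemann_dist_le:
  fixes \<gamma> \<eta> :: "real \<Rightarrow> 'a"
  assumes g: "geodesic \<gamma>" and h: "geodesic \<eta>" and t: "t \<in> {0..1}"
  shows "dist (\<gamma> t) (\<eta> t) \<le> (1 - t) * dist (\<gamma> 0) (\<eta> 0) + t * dist (\<gamma> 1) (\<eta> 1)"
proof -
  define F where "F t = dist (\<gamma> t) (\<eta> t) - ((1 - t) * dist (\<gamma> 0) (\<eta> 0) + t * dist (\<gamma> 1) (\<eta> 1))" for t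
  have "F t \<le> 0"
  proof (rule midpoint_convex_continuous_le_0[OF _ _ _ _ t])
    fix a b :: real assume ab: "a \<in> {0..1}" "b \<in> {0..1}"
    have "dist (\<gamma> ((a + b) / 2)) (\<eta> ((a + b) / 2)) \<le> (dist (\<gamma> a) (\<eta> a) + dist (\<gamma> b) (\<eta> b)) / 2"
      using busemann_midpoint[OF geodesic_sub[OF g ab] geodesic_sub[OF h ab]]
      by (simp add: field_simps)
    then show "F ((a + b) / 2) \<le> (F a + F b) / 2"
      unfolding F_def by (simp add: field_simps)
  next
    show "continuous_on {0..1} F"
      unfolding F_def by (intro continuous_intros geodesic_continuous_on g h)
  qed (simp_all add: F_def)
  then show ?thesis unfolding F_def by simp
qed

lemma geodesic_unique:
  fixes \<gamma> \<eta> :: "real \<Rightarrow> 'a"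
  assumes "geodesic \<gamma>" "geodesic \<eta>" "\<gamma> 0 = \<eta> 0" "\<gamma> 1 = \<eta> 1" "t \<in> {0..1}"
  shows "\<gamma> t = \<eta> t"
  using busemann_dist_le[OF assms(1,2,5)] assms(3,4) by simp

text \<open>Joining the segments from \<open>x\<close> to \<open>m\<close> and from \<open>m\<close>
  to \<open>y\<close> yields a geodesic, and there is only one.\<close>

lemma midpoint_unique:
  fixes x y m :: 'a
  assumes m: "2 * dist x m \<le> dist x y" "2 * dist m y \<le> dist x y"
  shows "m = segment x y (1/2)"
proof -
  define \<gamma> where "\<gamma> t = (if t \<le> 1/2 then segment x m (2 * t) else segment m y (2 * t - 1))" for t
  have ends: "\<gamma> 0 = x" "\<gamma> 1 = y" "\<gamma> (1/2) = m"
    unfolding \<gamma>_def by (simp_all add: segment)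
  have half: "dist (\<gamma> t) (\<gamma> s) \<le> (s - t) * dist x y"
    if "0 \<le> t" "t \<le> s" "s \<le> 1" "s \<le> 1/2 \<or> 1/2 \<le> t" for t s
    using that(4)
  proof
    assume "s \<le> 1/2"
    then have "dist (\<gamma> t) (\<gamma> s) = (s - t) * (2 * dist x m)"
      unfolding \<gamma>_def using that geodesic_dist[OF segment(1), of "2 * t" "2 * s" x m]
      by (simp add: segment)
    then show ?thesis using m(1) that by (simp add: mult_left_mono)
  next
    assume "1/2 \<le> t"
    \<comment> \<open>At \<open>u = 1/2\<close> the definition takes the first branch, but both
      branches give \<open>m\<close>.\<close>
    have "\<gamma> u = segment m y (2 * u - 1)" if "1/2 \<le> u" for u
    proof (cases "u = 1/2")
      case True
      show ?thesis unfolding True \<gamma>_def by (simp add: segment)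
    qed (use that in \<open>simp add: \<gamma>_def\<close>)
    then have "dist (\<gamma> t) (\<gamma> s) = (s - t) * (2 * dist m y)"
      using that \<open>1/2 \<le> t\<close> geodesic_dist[OF segment(1), of "2 * t - 1" "2 * s - 1" m y]
      by (simp add: segment)
    then show ?thesis using m(2) that by (simp add: mult_left_mono)
  qed
  have "geodesic \<gamma>"
  proof (rule geodesicI_le, unfold ends)
    fix t s :: real assume ts: "0 \<le> t" "t \<le> s" "s \<le> 1"
    show "dist (\<gamma> t) (\<gamma> s) \<le> (s - t) * dist x y"
    proof (cases "s \<le> 1/2 \<or> 1/2 \<le> t")
      case False
      then have "dist (\<gamma> t) (\<gamma> (1/2)) \<le> (1/2 - t) * dist x y"
        "dist (\<gamma> (1/2)) (\<gamma> s) \<le> (s - 1/2) * dist x y"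
        using ts by (auto intro!: half)
      then show ?thesis
        using dist_triangle[of "\<gamma> t" "\<gamma> s" "\<gamma> (1/2)"] by (simp add: algebra_simps)
    qed (use half ts in blast)
  qed
  then have "\<gamma> (1/2) = segment x y (1/2)"
    by (rule geodesic_unique) (simp_all add: segment ends)
  then show ?thesis using ends by simp
qed

section \<open>Equivalence of (A) and (NE)\<close>

lemma geod_convex_geodesic_image:
  fixes \<gamma> :: "real \<Rightarrow> 'a"
  assumes g: "geodesic \<gamma>"
  shows "geod_convex (\<gamma> ` {0..1})"
  unfolding geod_convex_def
proof (intro allI impI subsetI, elim conjE)
  fix \<beta> z assume b: "geodesic \<beta>" "\<beta> 0 \<in> \<gamma> ` {0..1}" "\<beta> 1 \<in> \<gamma> ` {0..1}" and "z \<in> \<beta> ` {0..1}"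
  then obtain a c t where act: "a \<in> {0..1}" "c \<in> {0..1}" "t \<in> {0..1}"
    "\<beta> 0 = \<gamma> a" "\<beta> 1 = \<gamma> c" "z = \<beta> t" by blast
  have "\<beta> t = \<gamma> (a + t * (c - a))"
    by (rule geodesic_unique[OF b(1) geodesic_sub[OF g act(1,2)]]) (use act in auto)
  then show "z \<in> \<gamma> ` {0..1}"
    using act affine_unit_interval by blast
qed

text \<open>Use (NE) for the image of \<open>\<gamma>\<close>, with \<open>\<gamma> t\<close> as
  second point: it is its own nearest point.\<close>

lemma prop_NE_imp_prop_A:
  assumes NE: "prop_NE TYPE('a)"
  shows "prop_A TYPE('a)"
  unfolding prop_A_def
proof (intro allI impI ballI)
  fix \<gamma> :: "real \<Rightarrow> 'a" and x xC and t :: real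
  assume g: "geodesic \<gamma>" and t: "t \<in> {0..1}" and xC: "xC \<in> proj (\<gamma> ` {0..1}) x"
  have "closed (\<gamma> ` {0..1})"
    by (intro compact_imp_closed compact_continuous_image geodesic_continuous_on g compact_Icc)
  moreover have "\<gamma> t \<in> proj (\<gamma> ` {0..1}) (\<gamma> t)"
    using t by (auto simp: mem_proj_iff)
  ultimately show "dist xC (\<gamma> t) \<le> dist x (\<gamma> t)"
    using NE geod_convex_geodesic_image[OF g] xC unfolding prop_NE_def by blast
qed

text \<open>The set of points within a given distance of a geodesic is convex, so \<^prop>\<open>prop_A TYPE('a)\<close>
  applies to it, and the nearest point in it lies on the perpendicular.\<close>

lemma descend_perpendicular:
  fixes \<gamma> U :: "real \<Rightarrow> 'a"
  assumes A: "prop_A TYPE('a)" and g: "geodesic \<gamma>" and U: "geodesic U"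
    and a: "a \<in> {0..1}" "U 0 = \<gamma> a"
    and near: "\<And>t. t \<in> {0..1} \<Longrightarrow> dist (U 0) (U 1) \<le> dist (U 1) (\<gamma> t)"
    and s: "0 \<le> s" "s \<le> s'" "s' \<le> 1"
    and z: "b \<in> {0..1}" "dist z (\<gamma> b) \<le> s * dist (U 0) (U 1)"
  shows "dist (U s) z \<le> dist (U s') z"
proof -
  define d where "d = dist (U 0) (U 1)"
  define \<zeta> where "\<zeta> = segment (U s) z"
  have \<zeta>: "geodesic \<zeta>" "\<zeta> 0 = U s" "\<zeta> 1 = z" unfolding \<zeta>_def by (simp_all add: segment)
  have Ud: "dist (U u) (U v) = \<bar>u - v\<bar> * d" if "u \<in> {0..1}" "v \<in> {0..1}" for u v
    using geodesic_dist[OF U that] d_def by simp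
  have "dist (\<zeta> 0) (\<zeta> 1) \<le> dist (U s') (\<zeta> 1)"
  proof (rule prop_A_dist_le[OF A \<zeta>(1)])
    fix t :: real assume t: "t \<in> {0..1}"
    \<comment> \<open>The companion \<open>g'\<close> runs along \<open>\<gamma>\<close> from the
      foot of \<open>U\<close> to \<open>\<gamma> b\<close>, so convexity of the distance keeps
      \<open>\<zeta> t\<close> within \<open>s * d\<close> of \<open>\<gamma>\<close>. As
      \<open>U 1\<close> is at least \<open>d\<close> away from \<open>\<gamma>\<close>, no
      \<open>\<zeta> t\<close> is closer to \<open>U s'\<close> than \<open>U s\<close> is.\<close>
    define g' where "g' = \<gamma> (a + t * (b - a))"
    have "dist (\<zeta> t) g' \<le> (1 - t) * dist (U s) (U 0) + t * dist z (\<gamma> b)"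
      using busemann_dist_le[OF \<zeta>(1) geodesic_sub[OF g a(1) z(1)] t] \<zeta> a unfolding g'_def by simp
    also have "\<dots> \<le> (1 - t) * (s * d) + t * (s * d)"
      using t s z Ud[of s 0] d_def by (intro add_mono mult_left_mono) auto
    finally have "dist (\<zeta> t) g' \<le> s * d" by (simp add: algebra_simps)
    moreover have "d \<le> dist (U 1) g'"
      unfolding g'_def d_def by (intro near affine_unit_interval a z t)
    moreover have "dist (U 1) g' \<le> dist (U 1) (U s') + dist (U s') (\<zeta> t) + dist (\<zeta> t) g'"
      using dist_triangle[of "U 1" g' "U s'"] dist_triangle[of "U s'" g' "\<zeta> t"] by linarith
    moreover have "dist (U 1) (U s') = (1 - s') * d" "dist (U s') (\<zeta> 0) = (s' - s) * d"
      using Ud[of 1 s'] Ud[of s' s] s \<zeta> by auto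
    ultimately show "dist (U s') (\<zeta> 0) \<le> dist (U s') (\<zeta> t)"
      by (simp add: algebra_simps)
  qed auto
  then show ?thesis using \<zeta> by simp
qed

text \<open>If the top side of a strip were shorter than all parallel levels, distances would have a
  corner along each level, and by \<^prop>\<open>prop_A TYPE('a)\<close> the slanted segments between two levels
  would be as short as the vertical ones. Two such segments give two geodesics with the same
  endpoints.\<close>

lemma no_contracting_strip:
  fixes \<gamma> \<sigma> U V :: "real \<Rightarrow> 'a"
  assumes A: "prop_A TYPE('a)"
    and g: "geodesic \<gamma>" and U: "geodesic U" and V: "geodesic V" and \<sigma>: "geodesic \<sigma>"
    and corners: "U 0 = \<gamma> 0" "V 0 = \<gamma> 1" "\<sigma> 0 = U 1" "\<sigma> 1 = V 1"
    and r: "dist (U 0) (U 1) = r" "dist (V 0) (V 1) = r"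
    and sep: "\<And>t t'. t \<in> {0..1} \<Longrightarrow> t' \<in> {0..1} \<Longrightarrow> r \<le> dist (\<sigma> t) (\<gamma> t')"
    and lt: "\<And>s. 0 \<le> s \<Longrightarrow> s < 1 \<Longrightarrow> dist (U 1) (V 1) < dist (U s) (V s)"
  shows False
proof -
  define G where "G s = segment (U s) (V s)" for s
  have G: "geodesic (G s)" "G s 0 = U s" "G s 1 = V s" for s
    unfolding G_def by (simp_all add: segment)
  define f where "f s = dist (U s) (V s)" for s
  have UV: "dist (U s) (U s') = \<bar>s - s'\<bar> * r" "dist (V s) (V s') = \<bar>s - s'\<bar> * r"
    if "s \<in> {0..1}" "s' \<in> {0..1}" for s s'
    using geodesic_dist[OF U that] geodesic_dist[OF V that] r by auto
  have vert: "dist (G s t) (G s' t) \<le> \<bar>s - s'\<bar> * r"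
    if "t \<in> {0..1}" "s \<in> {0..1}" "s' \<in> {0..1}" for t s s'
    using busemann_dist_le[OF G(1) G(1) that(1), of s s'] UV[OF that(2,3)] G
    by (simp add: algebra_simps)
  have low: "dist (G s t) (\<gamma> t) \<le> s * r" if "t \<in> {0..1}" "s \<in> {0..1}" for s t
    using busemann_dist_le[OF G(1) g that(1), of s] UV[OF that(2), of 0] that G corners
    by (simp add: algebra_simps)
  \<comment> \<open>With \<open>low\<close>, every point of level \<open>s\<close> has distance
    exactly \<open>s * r\<close> from \<open>\<gamma>\<close>.\<close>
  have high: "s * r \<le> dist (G s t) (\<gamma> t')"
    if "t \<in> {0..1}" "t' \<in> {0..1}" "s \<in> {0..1}" for s t t'
  proof -
    have "dist (\<sigma> t) (G s t) \<le> (1 - s) * r"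
      using busemann_dist_le[OF \<sigma> G(1) that(1), of s] UV[OF _ that(3), of 1] that G corners
      by (simp add: algebra_simps)
    then show ?thesis
      using sep[OF that(1,2)] dist_triangle[of "\<sigma> t" "\<gamma> t'" "G s t"] by (simp add: algebra_simps)
  qed
  \<comment> \<open>The heights differ by \<open>(s - w) * r\<close>, so \<open>V w\<close> is a
    nearest point to \<open>V s\<close> on level \<open>w\<close>.\<close>
  have cross: "f w \<le> dist (U w) (V s)" if "0 \<le> w" "w \<le> s" "s \<le> 1" for w s
  proof -
    have "dist (G w 1) (G w 0) \<le> dist (V s) (G w 0)"
    proof (rule prop_A_dist_le[OF A G(1)])
      fix t :: real assume t: "t \<in> {0..1}"
      have "s * r \<le> dist (V s) (\<gamma> t)" using high[of 1 t s] that t G by simp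
      moreover have "dist (G w t) (\<gamma> t) \<le> w * r" using low[of t w] that t by simp
      moreover have "dist (V s) (G w 1) = (s - w) * r" using UV[of s w] that G by simp
      ultimately show "dist (V s) (G w 1) \<le> dist (V s) (G w t)"
        using dist_triangle[of "V s" "\<gamma> t" "G w t"] by (simp add: algebra_simps)
    qed auto
    then show ?thesis using G unfolding f_def by (simp add: dist_commute)
  qed
  \<comment> \<open>\<open>f\<close> is convex, so left of \<open>s\<close> it lies above the line
    through its values at \<open>s\<close> and \<open>1\<close>; by \<open>lt\<close> this line
    falls strictly.\<close>
  have slope: "f s + (s - w) / (1 - s) * (f s - f 1) \<le> f w" if "0 \<le> w" "w \<le> s" "s < 1" for w s
  proof -
    define u where "u = (s - w) / (1 - w)"
    have u: "u \<in> {0..1}" "u * (1 - w) = s - w" "(1 - u) * (1 - w) = 1 - s"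
      using that unfolding u_def by (auto simp: field_simps)
    have "f s \<le> (1 - u) * f w + u * f 1"
      using busemann_dist_le[OF geodesic_sub[OF U, of w 1] geodesic_sub[OF V, of w 1] u(1)] u(2) that
      unfolding f_def by simp
    then have "f s * (1 - w) \<le> ((1 - u) * f w + u * f 1) * (1 - w)"
      using that by (intro mult_right_mono) auto
    also have "\<dots> = ((1 - u) * (1 - w)) * f w + (u * (1 - w)) * f 1"
      by (simp add: algebra_simps)
    finally have "f s * (1 - w) \<le> (1 - s) * f w + (s - w) * f 1"
      unfolding u .
    then show ?thesis using that by (simp add: field_simps)
  qed
  have slant: "\<exists>e>0. e \<le> 1 \<and> (\<forall>t\<in>{0..e}. dist (U s) (G s' t) \<le> (s - s') * r)"
    if s: "0 \<le> s'" "s' < s" "s < 1" for s s'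
  proof -
    \<comment> \<open>\<open>c\<close> is the lower bound from \<open>slope\<close> for
      \<open>f s' - f s\<close>; \<open>e\<close> keeps the sideways drift \<open>t * f s'\<close>
      of the slanted segment at most \<open>c\<close>.\<close>
    define c where "c = (s - s') / (1 - s) * (f s - f 1)"
    have c: "0 < c" unfolding c_def using s lt[of s] f_def by simp
    have fpos: "0 < f s'"
      using lt[of s'] s zero_le_dist[of "U 1" "V 1"] unfolding f_def by linarith
    define e where "e = min 1 (c / f s')"
    have "dist (U s) (G s' t) \<le> (s - s') * r" if "t \<in> {0..e}" for t
    proof -
      have t: "t \<in> {0..1}" "t * f s' \<le> c"
        using that fpos unfolding e_def by (auto simp: field_simps)
      define W where "W = segment (U s) (G s' t)"
      have W: "geodesic W" "W 0 = U s" "W 1 = G s' t" unfolding W_def by (simp_all add: segment)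
      \<comment> \<open>\<open>U s\<close> is nearest to \<open>G s t\<close> on \<open>W\<close>:
        the drift of \<open>W \<tau>\<close> from \<open>U w\<close> is at most
        \<open>\<tau> * c\<close>, which is compensated by \<open>U w\<close> being at least
        \<open>f s + \<tau> * c\<close> away from \<open>V s\<close>. So (A) compares the slanted
        segment with the vertical one.\<close>
      have "dist (W 0) (W 1) \<le> dist (G s t) (W 1)"
      proof (rule prop_A_dist_le[OF A W(1)])
        fix \<tau> :: real assume \<tau>: "\<tau> \<in> {0..1}"
        define w where "w = s + \<tau> * (s' - s)"
        have w01: "w \<in> {0..1}" unfolding w_def using s \<tau> by (intro affine_unit_interval) auto
        have w: "0 \<le> w" "w \<le> s" using w01 s \<tau> unfolding w_def by (auto simp: mult_le_0_iff)
        have "dist (U s') (G s' t) = t * f s'"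
          using geodesic_dist[OF G(1), of 0 t s'] t G unfolding f_def by simp
        then have "dist (W \<tau>) (U w) \<le> \<tau> * (t * f s')"
          using busemann_dist_le[OF W(1) geodesic_sub[OF U, of s s'] \<tau>] s W
          unfolding w_def by (simp add: dist_commute)
        also have "\<dots> \<le> \<tau> * c" using \<tau> t by (intro mult_left_mono) auto
        finally have 1: "dist (W \<tau>) (U w) \<le> \<tau> * c" .
        have 2: "f w \<le> dist (U w) (V s)" using cross w s by simp
        have "(s - w) / (1 - s) * (f s - f 1) = \<tau> * c"
          unfolding c_def w_def by (simp add: algebra_simps)
        then have 3: "f s + \<tau> * c \<le> f w" using slope[OF w s(3)] by simp
        have 4: "dist (G s t) (V s) = (1 - t) * f s" "dist (U s) (G s t) = t * f s"
          using geodesic_dist[OF G(1), of t 1 s] geodesic_dist[OF G(1), of 0 t s] t G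
          unfolding f_def by auto
        have "dist (U w) (V s) \<le> dist (W \<tau>) (U w) + dist (W \<tau>) (G s t) + dist (G s t) (V s)"
          using dist_triangle[of "U w" "V s" "W \<tau>"] dist_triangle[of "W \<tau>" "V s" "G s t"]
          by (simp add: dist_commute)
        then have "t * f s \<le> dist (W \<tau>) (G s t)"
          using 1 2 3 4 by (simp add: algebra_simps)
        then show "dist (G s t) (W 0) \<le> dist (G s t) (W \<tau>)"
          using 4 W by (simp add: dist_commute)
      qed auto
      then show ?thesis
        using vert[of t s s'] t s W by simp
    qed
    moreover have "0 < e" "e \<le> 1" unfolding e_def using c fpos by auto
    ultimately show ?thesis by blast
  qed
  \<comment> \<open>Three equally spaced levels below the top: from \<open>U (2/3)\<close> to
    \<open>G 0 t\<close> one may go via \<open>U (1/3)\<close> or via \<open>G (1/3) t\<close>.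
    Every piece has length at most \<open>r / 3\<close> and the total distance is at least
    \<open>2/3 * r\<close>, so both intermediate points are midpoints.\<close>
  obtain e1 where e1: "0 < e1" "e1 \<le> 1" "\<And>t. t \<in> {0..e1} \<Longrightarrow> dist (U (2/3)) (G (1/3) t) \<le> (2/3 - 1/3) * r"
    using slant[of "1/3" "2/3"] by auto
  obtain e2 where e2: "0 < e2" "e2 \<le> 1" "\<And>t. t \<in> {0..e2} \<Longrightarrow> dist (U (1/3)) (G 0 t) \<le> (1/3 - 0) * r"
    using slant[of 0 "1/3"] by auto
  define t where "t = min e1 e2"
  have t: "0 < t" "t \<in> {0..1}" "t \<in> {0..e1}" "t \<in> {0..e2}"
    using e1 e2 unfolding t_def by auto
  have far: "2/3 * r \<le> dist (U (2/3)) (G 0 t)"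
    using high[of 0 t "2/3"] low[of t 0] t G by simp
  have "G (1/3) t = segment (U (2/3)) (G 0 t) (1/2)"
    using far e1(3)[OF t(3)] vert[of t "1/3" 0] t by (intro midpoint_unique) auto
  moreover have "U (1/3) = segment (U (2/3)) (G 0 t) (1/2)"
    using far e2(3)[OF t(4)] UV(1)[of "2/3" "1/3"] by (intro midpoint_unique) auto
  ultimately have "dist (G (1/3) 0) (G (1/3) t) = 0" using G by simp
  moreover have "dist (G (1/3) 0) (G (1/3) t) = t * f (1/3)"
    using geodesic_dist[OF G(1), of 0 t "1/3"] t G unfolding f_def by simp
  moreover have "0 < f (1/3)"
    using lt[of "1/3"] zero_le_dist[of "U 1" "V 1"] unfolding f_def by linarith
  ultimately show False using t by simp
qed

text \<open>Otherwise let \<open>h\<close> be the least parameter with \<open>f h \<le> f 1\<close>.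
  If the segment from \<open>U h\<close> to \<open>V h\<close> came closer to
  \<open>\<gamma>\<close> than \<open>h * R\<close>, lowering both ends to that height would give a
  smaller such parameter. If not, it is the top of a strip excluded by
  \<open>no_contracting_strip\<close>.\<close>

lemma dist_feet_le_equal_height:
  fixes \<gamma> U V :: "real \<Rightarrow> 'a"
  assumes A: "prop_A TYPE('a)"
    and g: "geodesic \<gamma>" and U: "geodesic U" and V: "geodesic V"
    and corners: "U 0 = \<gamma> 0" "V 0 = \<gamma> 1"
    and R: "dist (U 0) (U 1) = R" "dist (V 0) (V 1) = R"
    and near: "\<And>t. t \<in> {0..1} \<Longrightarrow> R \<le> dist (U 1) (\<gamma> t)" "\<And>t. t \<in> {0..1} \<Longrightarrow> R \<le> dist (V 1) (\<gamma> t)"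
  shows "dist (U 0) (V 0) \<le> dist (U 1) (V 1)"
proof (rule ccontr)
  assume less: "\<not> ?thesis"
  define f where "f s = dist (U s) (V s)" for s
  have cont: "continuous_on {0..1} f"
    unfolding f_def by (intro continuous_intros geodesic_continuous_on U V)
  define S where "S = {s \<in> {0..1}. f s \<le> f 1}"
  have "closed S"
    unfolding S_def by (rule continuous_on_closed_Collect_le) (auto intro: cont continuous_intros)
  moreover have "1 \<in> S" and bdd: "bdd_below S"
    unfolding S_def by (auto intro: bdd_belowI[of _ 0])
  ultimately have "Inf S \<in> S" by (intro closed_contains_Inf) auto
  define h where "h = Inf S"
  have h: "h \<in> {0..1}" "f h \<le> f 1" using \<open>Inf S \<in> S\<close> unfolding h_def S_def by auto
  have below: "f 1 < f s" if "0 \<le> s" "s < h" for s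
  proof -
    have "s \<notin> S" using cInf_lower[OF _ bdd, of s] that unfolding h_def by auto
    then show ?thesis using that h unfolding S_def by auto
  qed
  have "h \<noteq> 0" using h less unfolding f_def by auto
  then have hpos: "0 < h" using h by auto
  \<comment> \<open>For \<open>R = 0\<close> the endpoints are their own feet.\<close>
  have "R \<noteq> 0" using R less by auto
  then have Rpos: "0 < R" using R zero_le_dist[of "U 0" "U 1"] by linarith
  define \<sigma> where "\<sigma> = segment (U h) (V h)"
  have \<sigma>: "geodesic \<sigma>" "\<sigma> 0 = U h" "\<sigma> 1 = V h" unfolding \<sigma>_def by (simp_all add: segment)
  have sep: "h * R \<le> dist (\<sigma> t) (\<gamma> t')" if t: "t \<in> {0..1}" "t' \<in> {0..1}" for t t'
  proof (rule ccontr)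
    assume less: "\<not> h * R \<le> dist (\<sigma> t) (\<gamma> t')"
    define s where "s = dist (\<sigma> t) (\<gamma> t') / R"
    have s: "0 \<le> s" "s < h" "dist (\<sigma> t) (\<gamma> t') = s * R"
      using Rpos less unfolding s_def by (auto simp: field_simps)
    have "dist (U s) (\<sigma> t) \<le> dist (U h) (\<sigma> t)"
      by (rule descend_perpendicular[OF A g U, where a = 0 and b = t'])
        (use s h t near R corners in auto)
    moreover have "dist (V s) (\<sigma> t) \<le> dist (V h) (\<sigma> t)"
      by (rule descend_perpendicular[OF A g V, where a = 1 and b = t'])
        (use s h t near R corners in auto)
    moreover have "dist (U h) (\<sigma> t) = t * f h" "dist (V h) (\<sigma> t) = (1 - t) * f h"
      using geodesic_dist[OF \<sigma>(1), of 0 t] geodesic_dist[OF \<sigma>(1), of 1 t] t \<sigma>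
      unfolding f_def by auto
    moreover have "f s \<le> dist (U s) (\<sigma> t) + dist (V s) (\<sigma> t)"
      unfolding f_def by (rule dist_triangle2)
    ultimately have "f s \<le> f h" by (simp add: algebra_simps)
    then show False using below[OF s(1,2)] h by simp
  qed
  \<comment> \<open>The strip is reparametrised so that height \<open>h\<close> becomes
    \<open>1\<close>; it contracts since \<open>f h \<le> f 1 < f (s * h)\<close>.\<close>
  show False
  proof (rule no_contracting_strip[OF A g geodesic_sub[OF U, of 0 h] geodesic_sub[OF V, of 0 h] \<sigma>(1), of "h * R"])
    fix s :: real assume "0 \<le> s" "s < 1"
    then have "f h < f (s * h)" using below[of "s * h"] h hpos by auto
    then show "dist (U (0 + 1 * (h - 0))) (V (0 + 1 * (h - 0))) < dist (U (0 + s * (h - 0))) (V (0 + s * (h - 0)))"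
      unfolding f_def by simp
  qed (use h \<sigma> corners sep geodesic_dist[OF U, of 0 h] geodesic_dist[OF V, of 0 h] R in auto)
qed

text \<open>Lowering \<open>x\<close> along its perpendicular to the height of \<open>y\<close> does
  not increase its distance to \<open>y\<close>, and \<open>p\<close> stays nearest on
  \<open>\<gamma>\<close>; this leaves the case of equal heights.\<close>

lemma dist_feet_le:
  fixes C :: "'a set"
  assumes A: "prop_A TYPE('a)" and C: "geod_convex C" "p \<in> C" "q \<in> C"
    and near: "\<And>z. z \<in> C \<Longrightarrow> dist x p \<le> dist x z" "\<And>z. z \<in> C \<Longrightarrow> dist y q \<le> dist y z"
    and le: "dist y q \<le> dist x p"
  shows "dist p q \<le> dist x y"
proof -
  define \<gamma> where "\<gamma> = segment p q"
  define U where "U = segment p x"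
  define V where "V = segment q y"
  have \<gamma>: "geodesic \<gamma>" "\<gamma> 0 = p" "\<gamma> 1 = q" unfolding \<gamma>_def by (simp_all add: segment)
  have U: "geodesic U" "U 0 = p" "U 1 = x" unfolding U_def by (simp_all add: segment)
  have V: "geodesic V" "V 0 = q" "V 1 = y" unfolding V_def by (simp_all add: segment)
  have inC: "\<gamma> t \<in> C" if "t \<in> {0..1}" for t
    using C \<gamma> that unfolding geod_convex_def by blast
  \<comment> \<open>If \<open>x = p\<close>, then \<open>le\<close> forces \<open>y = q\<close>, and
    division by zero gives \<open>s = 0\<close>.\<close>
  define s where "s = dist y q / dist x p"
  have s: "s \<in> {0..1}" using le unfolding s_def by (auto simp: divide_le_eq_1)
  have sd: "s * dist x p = dist y q"
    using le unfolding s_def by (cases "x = p") auto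
  have xs: "dist (U 1) (U s) = (1 - s) * dist x p" "dist (U 0) (U s) = s * dist x p"
    using geodesic_dist[OF U(1), of 1 s] geodesic_dist[OF U(1), of 0 s] s U
    by (auto simp: dist_commute)
  have "dist (U s) y \<le> dist (U 1) y"
    by (rule descend_perpendicular[OF A \<gamma>(1) U(1), where a = 0 and b = 1])
      (use U \<gamma> s sd near(1)[OF inC] in \<open>auto simp: dist_commute\<close>)
  moreover have "dist p q \<le> dist (U s) y"
  proof -
    have "dist y q \<le> dist (U s) (\<gamma> t)" if "t \<in> {0..1}" for t
      using near(1)[OF inC[OF that]] dist_triangle[of x "\<gamma> t" "U s"] xs U sd
      by (simp add: algebra_simps)
    then show ?thesis
      using dist_feet_le_equal_height[OF A \<gamma>(1) geodesic_sub[OF U(1), of 0 s] V(1), of "dist y q"]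
        U V \<gamma> s xs sd near(2)[OF inC] by (simp add: dist_commute)
  qed
  ultimately show ?thesis using U by simp
qed

lemma prop_A_imp_prop_NE:
  assumes A: "prop_A TYPE('a)"
  shows "prop_NE TYPE('a)"
  unfolding prop_NE_def
proof (intro allI impI ballI, elim conjE)
  fix C :: "'a set" and x y p q
  assume C: "geod_convex C" and p: "p \<in> proj C x" and q: "q \<in> proj C y"
  show "dist p q \<le> dist x y"
  proof (cases "dist y q \<le> dist x p")
    case True
    then show ?thesis
      using dist_feet_le[OF A C, of p q x y] p q by (simp add: mem_proj_iff)
  next
    case False
    then show ?thesis
      using dist_feet_le[OF A C, of q p y x] p q by (simp add: mem_proj_iff dist_commute)
  qed
qed

end

end

theorem theorem1:
  assumes "geodesic_space TYPE('a::complete_space)"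
    and "busemann_convex TYPE('a)"
  shows "(prop_SO TYPE('a) \<longleftrightarrow> prop_A TYPE('a)) \<and> (prop_A TYPE('a) \<longleftrightarrow> prop_NE TYPE('a))"
  using prop_A_imp_prop_SO prop_SO_imp_prop_A[OF assms(1)] prop_NE_imp_prop_A[OF assms]
    prop_A_imp_prop_NE[OF assms] by blast

end
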